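(* Let $s\ge 2$ and $m\ge 1$ be integers, let $\eta\ge 0$ be the damping parameter, and let $L>0$ be a constant of the real stability interval of the $s$-stage Runge-Kutta-Chebyshev (RKC) method, i.e. a real number such that its stability polynomial $R_s$ satisfies $|R_s(p)|\le 1$ for all $p\in[-Ls^2,0]$ (with $L\approx 0.65$ if $\eta=\tfrac{2}{13}$). Then the stability domain $$\{(p,q)\in\mathbb{R}^2 : |\ddot R_{s,m}(p,q)|\le 1\}$$ of the partitioned Runge-Kutta-Chebyshev method with parameters $s,m$ contains the rectangle $$S(s,m)=\Big\{(p,q)\in\mathbb{R}^2 \;:\; -Ls^2\le p\le 0,\ -2.15\,m\le q\le 2.15\,m\Big\}.$$
   Context: Let $T_j$ be the Chebyshev polynomial of the first kind of degree $j$. For an integer $s\ge2$ and damping parameter $\eta\ge 0$ put $$\omega_0=1+\frac{\eta}{s^2},\quad \omega_1=\frac{T_s'(\omega_0)}{T_s''(\omega_0)},\quad b_j=\frac{T_j''(\omega_0)}{(T_j'(\omega_0))^2}\ (2\le j\le s),\quad b_0=b_1=b_2,$$ $$\tilde u_1=\omega_1b_1,\quad \tilde u_j=2\omega_1\frac{b_j}{b_{j-1}},\quad u_j=2\omega_0\frac{b_j}{b_{j-1}},\quad v_j=-\frac{b_j}{b_{j-2}},\quad \tilde\gamma_j=-\big(1-b_{j-1}T_{j-1}(\omega_0)\big)\tilde u_j\quad(2\le j\le s).$$ Partitioned method: for the ODE $y'=f_D(y)+f_A(y)$, step size $h>0$ and integer $m\ge1$, one step $y_n\mapsto y_{n+1}$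 is $$\hat K_0=y_n,\qquad \hat K_i=\hat K_{i-1}+\tfrac{1}{2m}hf_A(\hat K_{i-1}),\quad i=1,\dots,m,$$ $$K_0=\hat K_m,\qquad K_1=K_0+\tilde u_1hf_D(K_0),$$ $$K_j=u_jK_{j-1}+v_jK_{j-2}+(1-u_j-v_j)K_0+\tilde u_jhf_D(K_{j-1})+\tilde\gamma_jhf_D(K_0),\quad j=2,\dots,s,$$ and for $i=1,\dots,m$ $$K_{s+3i-2}=K_{s+3i-3}+\tfrac{1}{6m}hf_A(K_{s+3i-3}),\qquad K_{s+3i-1}=K_{s+3i-3}-\tfrac{1}{6m}hf_A(K_{s+3i-2}),$$ $$K_{s+3i}=K_{s+3i-3}+\tfrac{2}{m}hf_A(K_{s+3i-3})-\tfrac{3}{2m}hf_A(K_{s+3i-1}),$$ and $y_{n+1}=K_{s+3m}$. Stability function: applying this method to the scalar test equation $y'=\lambda_1y+i\lambda_2y$ ($\lambda_1,\lambda_2\in\mathbb{R}$, $i$ the imaginary unit), with $f_D(y)=\lambda_1y$ and $f_A(y)=i\lambda_2y$, gives $y_{n+1}=\ddot R_{s,m}(p,q)y_n$ with $p=\lambda_1h$, $q=\lambda_2h$ and $$\ddot R_{s,m}(p,q)=\Big(1+\frac{iq}{2m}\Big)^m R_s(p)\Big(1+\frac{iq}{2m}+\frac{(iq)^2}{4m^2}+\frac{(iq)^3}{24m^3}\Big)^m,$$ where $R_s(p)=1-b_sT_s(\omega_0)+b_sT_s(\omega_0+\omega_1p)$ is the stability polynomial of the $s$-stage RKC method (the method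 obtained when $f_A\equiv0$). It is a known fact for the RKC method, recalled from the literature, that for $\eta=2/13$ the stability interval on the negative real axis is $[-Ls^2,0]$ with $L\approx0.65$. *)

theory Defs
  imports "HOL-Analysis.Analysis"
begin

fun chebyshev :: "nat \<Rightarrow> real poly" where
  "chebyshev 0 = 1"
| "chebyshev (Suc 0) = [:0, 1:]"
| "chebyshev (Suc (Suc n)) = [:0, 2:] * chebyshev (Suc n) - chebyshev n"

lemma chebyshev_cos: "poly (chebyshev n) (cos t) = cos (real n * t)"
proof (induction n rule: chebyshev.induct)
  case (3 n)
  have a: "real (Suc (Suc n)) * t = real (Suc n) * t + t"
    by (simp add: algebra_simps)
  have b: "real n * t = real (Suc n) * t - t"
    by (simp add: algebra_simps)
  have "cos (real (Suc (Suc n)) * t) = 2 * cos t * cos (real (Suc n) * t) - cos (real n * t)"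
    unfolding a b cos_add cos_diff by simp
  with 3 show ?case by simp
qed simp_all

definition omega0 :: "real \<Rightarrow> nat \<Rightarrow> real" where
  "omega0 \<eta> s = 1 + \<eta> / (real s)\<^sup>2"

definition omega1 :: "real \<Rightarrow> nat \<Rightarrow> real" where
  "omega1 \<eta> s =
     poly (pderiv (chebyshev s)) (omega0 \<eta> s) / poly (pderiv (pderiv (chebyshev s))) (omega0 \<eta> s)"

text \<open>The index \<^term>\<open>max 2 j\<close> encodes the convention that the coefficients
  with index 0 and 1 agree with the one with index 2.\<close>

definition rkc_b :: "real \<Rightarrow> nat \<Rightarrow> nat \<Rightarrow> real" where
  "rkc_b \<eta> s j =
     (let T = chebyshev (max 2 j); w = omega0 \<eta> s
      in poly (pderiv (pderiv T)) w / (poly (pderiv T) w)\<^sup>2)"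

definition rkc_ut :: "real \<Rightarrow> nat \<Rightarrow> nat \<Rightarrow> real" where
  "rkc_ut \<eta> s j =
     (if j = 1 then omega1 \<eta> s * rkc_b \<eta> s 1
      else 2 * omega1 \<eta> s * (rkc_b \<eta> s j / rkc_b \<eta> s (j - 1)))"

definition rkc_u :: "real \<Rightarrow> nat \<Rightarrow> nat \<Rightarrow> real" where
  "rkc_u \<eta> s j = 2 * omega0 \<eta> s * (rkc_b \<eta> s j / rkc_b \<eta> s (j - 1))"

definition rkc_v :: "real \<Rightarrow> nat \<Rightarrow> nat \<Rightarrow> real" where
  "rkc_v \<eta> s j = - (rkc_b \<eta> s j / rkc_b \<eta> s (j - 2))"

definition rkc_gt :: "real \<Rightarrow> nat \<Rightarrow> nat \<Rightarrow> real" where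
  "rkc_gt \<eta> s j =
     - (1 - rkc_b \<eta> s (j - 1) * poly (chebyshev (j - 1)) (omega0 \<eta> s)) * rkc_ut \<eta> s j"

text \<open>The RKC stages \<open>K\<^sub>0, \<dots>, K\<^sub>s\<close> started at \<open>y = K\<^sub>0\<close>.\<close>

fun rkc_stage ::
  "real \<Rightarrow> nat \<Rightarrow> real \<Rightarrow> ('a::real_vector \<Rightarrow> 'a) \<Rightarrow> 'a \<Rightarrow> nat \<Rightarrow> 'a" where
  "rkc_stage \<eta> s h fD y 0 = y"
| "rkc_stage \<eta> s h fD y (Suc 0) = y + (rkc_ut \<eta> s 1 * h) *\<^sub>R fD y"
| "rkc_stage \<eta> s h fD y (Suc (Suc k)) =
     (let j = Suc (Suc k); K1 = rkc_stage \<eta> s h fD y (Suc k); K2 = rkc_stage \<eta> s h fD y k in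
      rkc_u \<eta> s j *\<^sub>R K1 + rkc_v \<eta> s j *\<^sub>R K2 + (1 - rkc_u \<eta> s j - rkc_v \<eta> s j) *\<^sub>R y
      + (rkc_ut \<eta> s j * h) *\<^sub>R fD K1 + (rkc_gt \<eta> s j * h) *\<^sub>R fD y)"

definition rkc_step ::
  "real \<Rightarrow> nat \<Rightarrow> real \<Rightarrow> ('a::real_vector \<Rightarrow> 'a) \<Rightarrow> 'a \<Rightarrow> 'a" where
  "rkc_step \<eta> s h fD y = rkc_stage \<eta> s h fD y s"

definition euler_block :: "nat \<Rightarrow> real \<Rightarrow> ('a::real_vector \<Rightarrow> 'a) \<Rightarrow> 'a \<Rightarrow> 'a" where
  "euler_block m h fA K = K + (h / (2 * real m)) *\<^sub>R fA K"

text \<open>One pass \<open>K\<^bsub>s+3i-3\<^esub> \<mapsto> K\<^bsub>s+3i\<^esub>\<close>; \<open>K1\<close> and \<open>K2\<close> are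
  \<open>K\<^bsub>s+3i-2\<^esub>\<close> and \<open>K\<^bsub>s+3i-1\<^esub>\<close>.\<close>

definition three_stage_block :: "nat \<Rightarrow> real \<Rightarrow> ('a::real_vector \<Rightarrow> 'a) \<Rightarrow> 'a \<Rightarrow> 'a" where
  "three_stage_block m h fA K =
     (let K1 = K + (h / (6 * real m)) *\<^sub>R fA K;
          K2 = K - (h / (6 * real m)) *\<^sub>R fA K1
      in K + (2 * h / real m) *\<^sub>R fA K - (3 * h / (2 * real m)) *\<^sub>R fA K2)"

definition prkc_step ::
  "real \<Rightarrow> nat \<Rightarrow> nat \<Rightarrow> real \<Rightarrow> ('a::real_vector \<Rightarrow> 'a) \<Rightarrow> ('a \<Rightarrow> 'a) \<Rightarrow> 'a \<Rightarrow> 'a" where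
  "prkc_step \<eta> s m h fD fA y =
     (three_stage_block m h fA ^^ m) (rkc_step \<eta> s h fD ((euler_block m h fA ^^ m) y))"

definition rkc_R :: "real \<Rightarrow> nat \<Rightarrow> real \<Rightarrow> real" where
  "rkc_R \<eta> s p =
     1 - rkc_b \<eta> s s * poly (chebyshev s) (omega0 \<eta> s)
       + rkc_b \<eta> s s * poly (chebyshev s) (omega0 \<eta> s + omega1 \<eta> s * p)"

definition prkc_R :: "real \<Rightarrow> nat \<Rightarrow> nat \<Rightarrow> real \<Rightarrow> real \<Rightarrow> complex" where
  "prkc_R \<eta> s m p q =
     (let z = \<i> * complex_of_real q; M = of_nat m in
      (1 + z / (2 * M)) ^ m * complex_of_real (rkc_R \<eta> s p)
      * (1 + z / (2 * M) + z\<^sup>2 / (4 * M\<^sup>2) + z ^ 3 / (24 * M ^ 3)) ^ m)"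

definition prkc_stability_domain :: "real \<Rightarrow> nat \<Rightarrow> nat \<Rightarrow> (real \<times> real) set" where
  "prkc_stability_domain \<eta> s m = {(p, q). cmod (prkc_R \<eta> s m p q) \<le> 1}"

text \<open>The two stability functions really are the ones of the methods above.\<close>

lemma chebyshev_ge1:
  fixes x :: real
  assumes x: "x \<ge> 1"
  shows "poly (chebyshev n) x \<ge> 1 \<and> poly (chebyshev (Suc n)) x \<ge> poly (chebyshev n) x"
proof (induction n)
  case (Suc n)
  have "2 * x * poly (chebyshev (Suc n)) x \<ge> 2 * poly (chebyshev (Suc n)) x"
    using Suc x mult_right_mono[of 1 x "poly (chebyshev (Suc n)) x"] by simp
  moreover have "poly (chebyshev (Suc (Suc n))) x
      = 2 * x * poly (chebyshev (Suc n)) x - poly (chebyshev n) x"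
    by simp
  ultimately show ?case using Suc by linarith
qed (use x in simp)

lemma chebyshev_pderiv_Suc_Suc:
  fixes x :: real
  shows "poly (pderiv (chebyshev (Suc (Suc n)))) x =
    2 * poly (chebyshev (Suc n)) x + 2 * x * poly (pderiv (chebyshev (Suc n))) x
    - poly (pderiv (chebyshev n)) x"
  by (simp add: pderiv_mult pderiv_diff pderiv_pCons pderiv_smult algebra_simps)

lemma chebyshev_pderiv2_Suc_Suc:
  fixes x :: real
  shows "poly (pderiv (pderiv (chebyshev (Suc (Suc n))))) x =
    4 * poly (pderiv (chebyshev (Suc n))) x + 2 * x * poly (pderiv (pderiv (chebyshev (Suc n)))) x
    - poly (pderiv (pderiv (chebyshev n))) x"
  by (simp add: pderiv_mult pderiv_diff pderiv_add pderiv_pCons pderiv_smult algebra_simps)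

lemma chebyshev_pderiv_mono:
  fixes x :: real
  assumes x: "x \<ge> 1"
  shows "poly (pderiv (chebyshev n)) x \<ge> 0 \<and>
    poly (pderiv (chebyshev (Suc n))) x > poly (pderiv (chebyshev n)) x"
proof (induction n)
  case (Suc n)
  let ?d = "poly (pderiv (chebyshev (Suc n))) x"
  have "x * ?d \<ge> ?d"
    using Suc x mult_right_mono[of 1 x ?d] by simp
  moreover have "poly (chebyshev (Suc n)) x \<ge> 1"
    using chebyshev_ge1[OF x] by blast
  ultimately show ?case
    using Suc unfolding chebyshev_pderiv_Suc_Suc by linarith
qed (simp add: pderiv_pCons)

lemma chebyshev_pderiv2_mono:
  fixes x :: real
  assumes x: "x \<ge> 1"
  shows "poly (pderiv (pderiv (chebyshev (Suc n)))) x \<ge> 0 \<and>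
    poly (pderiv (pderiv (chebyshev (Suc (Suc n))))) x > poly (pderiv (pderiv (chebyshev (Suc n)))) x"
proof (induction n)
  case 0
  show ?case by (simp add: pderiv_pCons pderiv_mult pderiv_diff pderiv_add pderiv_smult)
next
  case (Suc n)
  let ?d = "poly (pderiv (pderiv (chebyshev (Suc (Suc n))))) x"
  have "x * ?d \<ge> ?d"
    using Suc x mult_right_mono[of 1 x ?d] by simp
  moreover have "poly (pderiv (chebyshev (Suc (Suc n)))) x > 0"
    using chebyshev_pderiv_mono[OF x, of "Suc n"] by linarith
  ultimately show ?case
    using Suc unfolding chebyshev_pderiv2_Suc_Suc[of "Suc n"] by linarith
qed

lemma omega0_ge1: "\<eta> \<ge> 0 \<Longrightarrow> omega0 \<eta> s \<ge> 1"
  by (simp add: omega0_def)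

lemma rkc_b_pos:
  assumes "\<eta> \<ge> 0"
  shows "rkc_b \<eta> s j > 0"
proof -
  note x = omega0_ge1[OF assms, of s]
  obtain n where n: "max 2 j = Suc (Suc n)"
    by (metis Suc_1 le_Suc_ex max.cobounded1 add_Suc plus_1_eq_Suc)
  show ?thesis
    unfolding rkc_b_def Let_def n
    using chebyshev_pderiv_mono[OF x, of "Suc n"] chebyshev_pderiv2_mono[OF x, of n]
    by (auto intro!: divide_pos_pos)
qed

lemma rkc_stage_linear:
  fixes y :: complex
  assumes \<eta>: "\<eta> \<ge> 0"
  shows "rkc_stage \<eta> s h (\<lambda>y. of_real l * y) y j =
    of_real (1 - rkc_b \<eta> s j * poly (chebyshev j) (omega0 \<eta> s)
      + rkc_b \<eta> s j * poly (chebyshev j) (omega0 \<eta> s + omega1 \<eta> s * (l * h))) * y"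
proof (induction j rule: chebyshev.induct)
  case 1
  show ?case by simp
next
  case 2
  show ?case by (simp add: rkc_ut_def rkc_b_def scaleR_conv_of_real algebra_simps)
next
  case (3 n)
  define w where "w = omega0 \<eta> s"
  define w1 where "w1 = omega1 \<eta> s"
  define b0 where "b0 = rkc_b \<eta> s n"
  define b1 where "b1 = rkc_b \<eta> s (Suc n)"
  define b2 where "b2 = rkc_b \<eta> s (Suc (Suc n))"
  define T0 where "T0 = poly (chebyshev n) w"
  define T1 where "T1 = poly (chebyshev (Suc n)) w"
  define t0 where "t0 = poly (chebyshev n) (w + w1 * (l * h))"
  define t1 where "t1 = poly (chebyshev (Suc n)) (w + w1 * (l * h))"
  define r1 where "r1 = b2 / b1"
  define r0 where "r0 = b2 / b0"
  define u where "u = 2 * w * r1"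
  define v where "v = - r0"
  define g where "g = 2 * w1 * r1"
  define k1 where "k1 = 1 - b1 * T1 + b1 * t1"
  define k0 where "k0 = 1 - b0 * T0 + b0 * t0"
  have nz: "b0 \<noteq> 0" "b1 \<noteq> 0"
    using rkc_b_pos[OF \<eta>, of s] by (simp_all add: b0_def b1_def less_imp_neq[symmetric])
  have c1: "r1 * b1 = b2" and c0: "r0 * b0 = b2"
    using nz by (simp_all add: r1_def r0_def)
  have key: "u * k1 + v * k0 + (1 - u - v) + g * (l * h) * k1 - (1 - b1 * T1) * g * (l * h)
    = 1 - b2 * (2 * w * T1 - T0) + b2 * (2 * (w + w1 * (l * h)) * t1 - t0)"
  proof -
    have "u * k1 + v * k0 + (1 - u - v) + g * (l * h) * k1 - (1 - b1 * T1) * g * (l * h)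
      = 1 + 2 * w * (r1 * b1) * (t1 - T1) - (r0 * b0) * (t0 - T0)
        + 2 * w1 * (r1 * b1) * (l * h) * t1"
      unfolding u_def v_def g_def k1_def k0_def by (simp add: algebra_simps)
    also have "\<dots> = 1 - b2 * (2 * w * T1 - T0) + b2 * (2 * (w + w1 * (l * h)) * t1 - t0)"
      unfolding c0 c1 by (simp add: algebra_simps)
    finally show ?thesis .
  qed
  have ih: "rkc_stage \<eta> s h (\<lambda>y. of_real l * y) y n = of_real k0 * y"
    "rkc_stage \<eta> s h (\<lambda>y. of_real l * y) y (Suc n) = of_real k1 * y"
    using 3 by (simp_all add: k0_def k1_def b0_def b1_def T0_def T1_def t0_def t1_def w_def w1_def)
  have cheb: "poly (chebyshev (Suc (Suc n))) x
      = 2 * x * poly (chebyshev (Suc n)) x - poly (chebyshev n) x" for x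
    by simp
  have coeff: "rkc_u \<eta> s (Suc (Suc n)) = u" "rkc_v \<eta> s (Suc (Suc n)) = v"
    "rkc_ut \<eta> s (Suc (Suc n)) = g" "rkc_gt \<eta> s (Suc (Suc n)) = - (1 - b1 * T1) * g"
    by (simp_all add: rkc_u_def rkc_v_def rkc_ut_def rkc_gt_def
        u_def v_def g_def r0_def r1_def b0_def b1_def b2_def T1_def w_def w1_def)
  have "rkc_stage \<eta> s h (\<lambda>y. of_real l * y) y (Suc (Suc n)) =
    of_real (u * k1 + v * k0 + (1 - u - v) + g * (l * h) * k1 - (1 - b1 * T1) * g * (l * h)) * y"
    unfolding rkc_stage.simps ih Let_def coeff scaleR_conv_of_real
    by (simp add: algebra_simps)
  also have "\<dots> = of_real (1 - b2 * (2 * w * T1 - T0)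
      + b2 * (2 * (w + w1 * (l * h)) * t1 - t0)) * y"
    unfolding key ..
  finally show ?case
    unfolding cheb b2_def T0_def T1_def t0_def t1_def w_def w1_def .
qed

theorem rkc_step_test_equation:
  fixes y :: complex
  assumes "\<eta> \<ge> 0"
  shows "rkc_step \<eta> s h (\<lambda>y. of_real l * y) y = of_real (rkc_R \<eta> s (l * h)) * y"
  unfolding rkc_step_def rkc_R_def by (rule rkc_stage_linear[OF assms])

lemma funpow_mult: "((\<lambda>y::complex. c * y) ^^ n) y = c ^ n * y"
  by (induction n) (simp_all add: algebra_simps)

theorem prkc_step_test_equation:
  fixes y :: complex
  assumes "\<eta> \<ge> 0" "m \<ge> 1"
  shows "prkc_step \<eta> s m h (\<lambda>y. of_real l1 * y) (\<lambda>y. \<i> * of_real l2 * y) y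
    = prkc_R \<eta> s m (l1 * h) (l2 * h) * y"
proof -
  define z where "z = \<i> * complex_of_real (l2 * h)"
  define M where "M = complex_of_nat m"
  have M: "M \<noteq> 0" using assms by (simp add: M_def)
  have e: "euler_block m h (\<lambda>y. \<i> * of_real l2 * y) = (\<lambda>y. (1 + z / (2 * M)) * y)"
    by (rule ext) (simp add: euler_block_def z_def M_def scaleR_conv_of_real algebra_simps)
  have t: "three_stage_block m h (\<lambda>y. \<i> * of_real l2 * y)
    = (\<lambda>y. (1 + z / (2 * M) + z\<^sup>2 / (4 * M\<^sup>2) + z ^ 3 / (24 * M ^ 3)) * y)"
  proof
    fix K :: complex
    define x where "x = z / M"
    have s1: "(h / (6 * real m)) *\<^sub>R (\<i> * of_real l2 * L) = x / 6 * L"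
      "(2 * h / real m) *\<^sub>R (\<i> * of_real l2 * L) = 2 * x * L"
      "(3 * h / (2 * real m)) *\<^sub>R (\<i> * of_real l2 * L) = 3 / 2 * x * L" for L :: complex
      by (simp_all add: x_def z_def M_def scaleR_conv_of_real mult_ac)
    have p: "z / (2 * M) = x / 2" "z\<^sup>2 / (4 * M\<^sup>2) = x\<^sup>2 / 4" "z ^ 3 / (24 * M ^ 3) = x ^ 3 / 24"
      by (simp_all add: x_def power_divide)
    show "three_stage_block m h (\<lambda>y. \<i> * of_real l2 * y) K
      = (1 + z / (2 * M) + z\<^sup>2 / (4 * M\<^sup>2) + z ^ 3 / (24 * M ^ 3)) * K"
      unfolding three_stage_block_def Let_def s1 p
      by (simp add: field_simps power2_eq_square power3_eq_cube)
  qed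
  show ?thesis
    unfolding prkc_step_def e t funpow_mult rkc_step_test_equation[OF assms(1)]
      prkc_R_def Let_def z_def[symmetric] M_def[symmetric]
    by (simp only: ac_simps)
qed

lemma prkc_step_no_advection: "prkc_step \<eta> s m h fD (\<lambda>_. 0) = rkc_step \<eta> s h fD"
proof -
  have "(euler_block m h (\<lambda>_. 0) ^^ n) y = y" "(three_stage_block m h (\<lambda>_. 0) ^^ n) y = y"
    for n and y :: 'a
    by (induction n) (simp_all add: euler_block_def three_stage_block_def)
  then show ?thesis
    by (simp add: fun_eq_iff prkc_step_def)
qed

end

theory Submission
  imports Defs
begin

text \<open>
  The stability function factorises as \<open>w\<^sup>m R\<^sub>s(p)\<close>, where \<open>w\<close> depends only on \<open>x = q/m\<close>. With \<open>t = x\<^sup>2\<close>,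
  one finds \<open>|w|\<^sup>2 = 1 + t\<^sup>2 (t\<^sup>2 + 16 t - 96) / 2304\<close>, which is at most 1 as long as
  \<open>t \<le> sqrt 160 - 8 \<approx> 4.649\<close>, and \<open>2.15\<^sup>2 = 4.6225\<close>.
\<close>

text \<open>Amplification of one Euler substep paired with one three-stage substep; scalar factors
  commute, so the \<open>m\<close> pairs form an \<open>m\<close>-th power.\<close>

definition advection_factor :: "real \<Rightarrow> complex" where
  "advection_factor x =
     (let z = \<i> * complex_of_real x in (1 + z / 2) * (1 + z / 2 + z\<^sup>2 / 4 + z ^ 3 / 24))"

lemma prkc_R_eq_advection_factor:
  "prkc_R \<eta> s m p q = advection_factor (q / real m) ^ m * complex_of_real (rkc_R \<eta> s p)"
  by (simp add: prkc_R_def advection_factor_def Let_def power_mult_distrib power_divide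
      mult.commute mult.left_commute)

text \<open>The terms in \<open>x\<^sup>2\<close> of the two squared moduli, 1/4 and -1/4, cancel in
  the product, so \<open>x ^ 4\<close> splits off and the sign of the quadratic in
  \<open>x\<^sup>2\<close> decides.\<close>

lemma cmod_advection_factor_sq:
  "(cmod (advection_factor x))\<^sup>2 = 1 + x ^ 4 * (x ^ 4 + 16 * x\<^sup>2 - 96) / 2304"
proof -
  have "1 + \<i> * complex_of_real x / 2 = Complex 1 (x / 2)"
    by (simp add: complex_eq_iff)
  moreover have "1 + \<i> * complex_of_real x / 2 + (\<i> * complex_of_real x)\<^sup>2 / 4
      + (\<i> * complex_of_real x) ^ 3 / 24 = Complex (1 - x\<^sup>2 / 4) (x / 2 - x ^ 3 / 24)"
    by (simp add: complex_eq_iff power2_eq_square power3_eq_cube)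
  ultimately have "(cmod (advection_factor x))\<^sup>2 =
      (1 + (x / 2)\<^sup>2) * ((1 - x\<^sup>2 / 4)\<^sup>2 + (x / 2 - x ^ 3 / 24)\<^sup>2)"
    by (simp add: advection_factor_def norm_mult power_mult_distrib cmod_power2)
  then show ?thesis
    by (simp add: field_simps power2_eq_square power3_eq_cube power4_eq_xxxx)
qed

lemma cmod_advection_factor_le_1:
  assumes "\<bar>x\<bar> \<le> 2.15"
  shows "cmod (advection_factor x) \<le> 1"
proof -
  have t: "x\<^sup>2 \<le> 4.6225"
    using power_mono[OF assms, of 2] by (simp add: power2_eq_square)
  have "x ^ 4 \<le> 4.6225\<^sup>2"
    using power_mono[OF t, of 2] by simp
  \<comment> \<open>Both monomials are largest at the endpoint, where the sum is about
    -0.67.\<close>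
  then have "x ^ 4 + 16 * x\<^sup>2 - 96 \<le> 0"
    using t by (simp add: power2_eq_square)
  then have "x ^ 4 * (x ^ 4 + 16 * x\<^sup>2 - 96) \<le> 0"
    by (simp add: mult_nonneg_nonpos)
  then have "(cmod (advection_factor x))\<^sup>2 \<le> 1"
    by (simp add: cmod_advection_factor_sq)
  then show ?thesis
    by (simp add: abs_square_le_1)
qed

theorem theorem3p1:
  fixes s m :: nat and \<eta> L :: real
  assumes "s \<ge> 2" and "m \<ge> 1" and "\<eta> \<ge> 0" and "L > 0"
    and "\<forall>p \<in> {- L * (real s)\<^sup>2 .. 0}. \<bar>rkc_R \<eta> s p\<bar> \<le> 1"
  shows "{(p, q). - L * (real s)\<^sup>2 \<le> p \<and> p \<le> 0 \<and> - 2.15 * real m \<le> q \<and> q \<le> 2.15 * real m}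
    \<subseteq> prkc_stability_domain \<eta> s m"
proof -
  have "cmod (prkc_R \<eta> s m p q) \<le> 1"
    if p: "- L * (real s)\<^sup>2 \<le> p" "p \<le> 0" and q: "- 2.15 * real m \<le> q" "q \<le> 2.15 * real m" for p q
  proof -
    \<comment> \<open>Dividing by \<open>m\<close> reduces every strip to the case of one substep
      pair.\<close>
    have "\<bar>q / real m\<bar> \<le> 2.15"
      using q \<open>m \<ge> 1\<close> by (simp add: abs_le_iff field_simps)
    then have "cmod (advection_factor (q / real m)) ^ m \<le> 1"
      by (intro power_le_one cmod_advection_factor_le_1) auto
    moreover have "\<bar>rkc_R \<eta> s p\<bar> \<le> 1"
      using assms(5) p by simp
    ultimately show ?thesis
      by (simp add: prkc_R_eq_advection_factor norm_mult norm_power mult_le_one)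
  qed
  then show ?thesis
    by (auto simp: prkc_stability_domain_def)
qed

end
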